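(* Let $G$ be a compact abelian topological group and let $f:G\to G$ be a continuous endomorphism. Then the chain recurrent set $\mathrm{CR}(f)$ is a recurrent subgroup, i.e. the assignment $\mathfrak{R}=\mathrm{CR}$ satisfies properties (R1)--(R4) stated in the context.
   Context: $e$ is the identity of $G$ and $\mathfrak{B}_e$ is a fundamental system of symmetric neighborhoods of $e$ in $G$. For $E\in\mathfrak{B}_e$ and $x,y\in G$, an $E$-chain of $f$ from $x$ to $y$ is a finite sequence $x_0,x_1,\dots,x_n$ in $G$ ($n\ge 1$) with $x_0=x$, $x_n=y$ and $f(x_i)x_{i+1}^{-1}\in E$ for $0\le i\le n-1$. Write $x\rightsquigarrow y$ if for every $E\in\mathfrak{B}_e$ there is an $E$-chain from $x$ to $y$. The chain recurrent set is $\mathrm{CR}(f)=\{x\in G : x\rightsquigarrow x\}$. Recurrent subgroup: suppose that a subset $\mathfrak{R}(f)\subseteq G$ is assigned to each continuous endomorphism $f$ of a compact abelian topological group $G$. $\mathfrak{R}(f)$ is called a recurrent subgroup if: (R1) $\mathfrak{R}(f)$ is a subgroup of $G$; (R2) $f(\mathfrak{R}(f))\subseteq \mathfrak{R}(f)$; (R3) $\mathfrak{R}(f)$ is closed in $G$; (R4) $\mathfrak{R}(f)$ is invariant under topological conjugacy: if $f:G\to G$ and $g:H\to H$ are continuous endomorphisms of (compact abelian) topological groups and $\phi:G\to H$ is a continuous group isomorphism with continuous inverse such that $\phi\circ f=g\circ\phi$, then $\mathfrak{R}(g)=\phi(\mathfrak{R}(f))$. *)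

theory Defs
  imports "HOL-Algebra.Group" "HOL-Analysis.Analysis"
begin

locale topological_group = group G for G :: "'a monoid" (structure) +
  fixes T :: "'a topology"
  assumes topspace_eq_carrier: "topspace T = carrier G"
    and continuous_mult: "continuous_map (prod_topology T T) T (\<lambda>(x, y). x \<otimes> y)"
    and continuous_inv: "continuous_map T T (\<lambda>x. inv x)"

text \<open>Compactness does not include the Hausdorff property.\<close>

locale compact_abelian_topological_group = topological_group G T + comm_group G
  for G :: "'a monoid" (structure) and T :: "'a topology" +
  assumes compact: "compact_space T"

definition continuous_endomorphism :: "'a monoid \<Rightarrow> 'a topology \<Rightarrow> ('a \<Rightarrow> 'a) \<Rightarrow> bool" where
  "continuous_endomorphism G T f \<longleftrightarrow> f \<in> hom G G \<and> continuous_map T T f"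

text \<open>Neighborhoods need not be open.\<close>

definition neighborhood :: "'a topology \<Rightarrow> 'a \<Rightarrow> 'a set \<Rightarrow> bool" where
  "neighborhood T x V \<longleftrightarrow> V \<subseteq> topspace T \<and> (\<exists>W. openin T W \<and> x \<in> W \<and> W \<subseteq> V)"

definition symmetric_nbhd_base :: "'a monoid \<Rightarrow> 'a topology \<Rightarrow> 'a set set \<Rightarrow> bool" where
  "symmetric_nbhd_base G T \<B> \<longleftrightarrow>
     (\<forall>E\<in>\<B>. neighborhood T \<one>\<^bsub>G\<^esub> E \<and> (\<lambda>x. inv\<^bsub>G\<^esub> x) ` E = E) \<and>
     neighbourhood_base_at \<one>\<^bsub>G\<^esub> (\<lambda>E. E \<in> \<B>) T"

text \<open>A chain \<open>x\<^sub>0, \<dots>, x\<^sub>n\<close> is given by a function on the naturals, of which only the values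
  at \<open>0, \<dots>, n\<close> matter.\<close>

definition is_chain ::
  "'a monoid \<Rightarrow> ('a \<Rightarrow> 'a) \<Rightarrow> 'a set \<Rightarrow> 'a \<Rightarrow> 'a \<Rightarrow> nat \<Rightarrow> (nat \<Rightarrow> 'a) \<Rightarrow> bool" where
  "is_chain G f E x y n s \<longleftrightarrow>
     n \<ge> 1 \<and> (\<forall>i\<le>n. s i \<in> carrier G) \<and> s 0 = x \<and> s n = y \<and>
     (\<forall>i<n. f (s i) \<otimes>\<^bsub>G\<^esub> inv\<^bsub>G\<^esub> (s (Suc i)) \<in> E)"

definition chain_leads_to ::
  "'a monoid \<Rightarrow> 'a set set \<Rightarrow> ('a \<Rightarrow> 'a) \<Rightarrow> 'a \<Rightarrow> 'a \<Rightarrow> bool" where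
  "chain_leads_to G \<B> f x y \<longleftrightarrow> (\<forall>E\<in>\<B>. \<exists>n s. is_chain G f E x y n s)"

definition chain_recurrent_set :: "'a monoid \<Rightarrow> 'a set set \<Rightarrow> ('a \<Rightarrow> 'a) \<Rightarrow> 'a set" where
  "chain_recurrent_set G \<B> f = {x \<in> carrier G. chain_leads_to G \<B> f x x}"

definition topological_conjugacy ::
  "'a monoid \<Rightarrow> 'a topology \<Rightarrow> ('a \<Rightarrow> 'a) \<Rightarrow> 'b monoid \<Rightarrow> 'b topology \<Rightarrow> ('b \<Rightarrow> 'b) \<Rightarrow> ('a \<Rightarrow> 'b) \<Rightarrow> bool"
where
  "topological_conjugacy G T f H U g \<phi> \<longleftrightarrow>
     \<phi> \<in> iso G H \<and> homeomorphic_map T U \<phi> \<and> (\<forall>x\<in>carrier G. \<phi> (f x) = g (\<phi> x))"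

text \<open>An assignment of subsets ranges over groups on arbitrary carrier types, which a single HOL
  variable cannot do. So \<open>R\<close> and \<open>R'\<close> stand for one assignment, at the type of \<open>G\<close> and at the type
  of the conjugate group \<open>H\<close>.\<close>

definition recurrent_subgroup ::
  "('a monoid \<Rightarrow> 'a topology \<Rightarrow> ('a \<Rightarrow> 'a) \<Rightarrow> 'a set) \<Rightarrow>
   ('b monoid \<Rightarrow> 'b topology \<Rightarrow> ('b \<Rightarrow> 'b) \<Rightarrow> 'b set) \<Rightarrow>
   'a monoid \<Rightarrow> 'a topology \<Rightarrow> ('a \<Rightarrow> 'a) \<Rightarrow> bool" where
  "recurrent_subgroup R R' G T f \<longleftrightarrow>
     subgroup (R G T f) G \<and>
     f ` R G T f \<subseteq> R G T f \<and>
     closedin T (R G T f) \<and>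
     (\<forall>H U g \<phi>. compact_abelian_topological_group H U \<longrightarrow> continuous_endomorphism H U g \<longrightarrow>
        topological_conjugacy G T f H U g \<phi> \<longrightarrow> R' H U g = \<phi> ` R G T f)"

end

theory Submission imports Defs begin

text \<open>
  A closed \<open>E\<close>-chain through \<open>x\<close>, traversed again and again, is a periodic sequence that starts at
  \<open>x\<close> and moves by \<open>f\<close> up to an error in \<open>E\<close>. Periodic sequences can be multiplied termwise even if
  their periods differ, because the product of the periods is a common period. If \<open>G\<close> is abelian
  and \<open>f\<close> is an endomorphism, then errors multiply as well, so for \<open>E\<close> with \<open>E E \<subseteq> W\<close> the set
  \<open>P E\<close> of starting points satisfies \<open>P E P E \<subseteq> P W\<close> (lemma \<open>periodic_chain_points_mult\<close>). Since
  \<open>CR f\<close> is the intersection of all \<open>P W\<close> for open \<open>W\<close> containing the identity, it is closed under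
  products.

  The same inclusion shows that \<open>CR f\<close> is topologically closed. Every \<open>v\<close> near the identity has
  \<open>f v v\<^sup>-\<^sup>1 \<in> E\<close>, so the constant sequence \<open>v\<close> puts \<open>v\<close> into \<open>P E\<close>. If \<open>x\<close> is a limit of chain
  recurrent points, then \<open>x = y v\<close> with \<open>y \<in> CR f \<subseteq> P E\<close> and such a \<open>v\<close>, hence \<open>x \<in> P W\<close>.

  Everything else comes from one functoriality principle, lemma \<open>chain_recurrent_set_semiconjugacy\<close>:
  a continuous homomorphism \<open>\<phi>\<close> with \<open>\<phi> \<circ> f = g \<circ> \<phi>\<close> maps \<open>CR f\<close> into \<open>CR g\<close>. With \<open>\<phi> = f\<close>
  it gives invariance under \<open>f\<close>, with \<open>\<phi>\<close> the inversion of the abelian group it gives closure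
  under inverses, and applied to a conjugacy and to its inverse it gives invariance under conjugacy.
\<close>

section \<open>Closed chains as periodic sequences\<close>

text \<open>A closed chain is unrolled to an infinite periodic sequence, so that two closed chains of
  different lengths can be combined index by index.\<close>

definition periodic_chain_points ::
  "('a, 'm) monoid_scheme \<Rightarrow> ('a \<Rightarrow> 'a) \<Rightarrow> 'a set \<Rightarrow> 'a set" where
  "periodic_chain_points G f E =
     {x. \<exists>n s. n \<ge> 1 \<and> (\<forall>i. s i \<in> carrier G) \<and> s 0 = x \<and> (\<forall>i. s (i + n) = s i) \<and>
           (\<forall>i. f (s i) \<otimes>\<^bsub>G\<^esub> inv\<^bsub>G\<^esub> (s (Suc i)) \<in> E)}"

lemma periodic_chain_pointsI:
  assumes "n \<ge> 1" "\<And>i. s i \<in> carrier G" "s 0 = x" "\<And>i::nat. s (i + n) = s i"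
    and "\<And>i. f (s i) \<otimes>\<^bsub>G\<^esub> inv\<^bsub>G\<^esub> (s (Suc i)) \<in> E"
  shows "x \<in> periodic_chain_points G f E"
  unfolding periodic_chain_points_def using assms by blast

lemma periodic_chain_pointsE:
  assumes "x \<in> periodic_chain_points G f E"
  obtains n s where "n \<ge> 1" "\<And>i. s i \<in> carrier G" "s 0 = x" "\<And>i::nat. s (i + n) = s i"
    "\<And>i. f (s i) \<otimes>\<^bsub>G\<^esub> inv\<^bsub>G\<^esub> (s (Suc i)) \<in> E"
  using assms unfolding periodic_chain_points_def by blast

lemma periodic_add_mult:
  fixes s :: "nat \<Rightarrow> 'a"
  assumes "\<And>i. s (i + n) = s i"
  shows "s (i + k * n) = s i"
proof (induction k)
  case (Suc k)
  have "s (i + Suc k * n) = s (i + k * n + n)"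
    by (simp add: algebra_simps)
  then show ?case
    using assms Suc.IH by simp
qed simp

lemma periodic_chain_points_iff:
  "x \<in> periodic_chain_points G f E \<longleftrightarrow> (\<exists>n s. is_chain G f E x x n s)"
proof
  assume "x \<in> periodic_chain_points G f E"
  then obtain n s where s: "n \<ge> 1" "\<And>i. s i \<in> carrier G" "s 0 = x" "\<And>i::nat. s (i + n) = s i"
    "\<And>i. f (s i) \<otimes>\<^bsub>G\<^esub> inv\<^bsub>G\<^esub> (s (Suc i)) \<in> E"
    by (rule periodic_chain_pointsE) blast
  then have "is_chain G f E x x n s"
    unfolding is_chain_def using s(4)[of 0] by simp
  then show "\<exists>n s. is_chain G f E x x n s"
    by blast
next
  assume "\<exists>n s. is_chain G f E x x n s"
  then obtain n s where s: "n \<ge> 1" "\<And>i. i \<le> n \<Longrightarrow> s i \<in> carrier G" "s 0 = x" "s n = x"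
    "\<And>i. i < n \<Longrightarrow> f (s i) \<otimes>\<^bsub>G\<^esub> inv\<^bsub>G\<^esub> (s (Suc i)) \<in> E"
    unfolding is_chain_def by blast
  have mod_less: "i mod n < n" for i
    using s(1) by simp
  have "f (s (i mod n)) \<otimes>\<^bsub>G\<^esub> inv\<^bsub>G\<^esub> (s (Suc i mod n)) \<in> E" for i
  proof -
    have "s (Suc i mod n) = s (Suc (i mod n))"
      using s(3,4) by (auto simp: mod_Suc)
    then show ?thesis
      using s(5)[OF mod_less] by simp
  qed
  then show "x \<in> periodic_chain_points G f E"
    using s mod_less by (intro periodic_chain_pointsI[of n "\<lambda>i. s (i mod n)"]) (auto simp: less_imp_le)
qed

lemma periodic_chain_points_mono:
  "E \<subseteq> F \<Longrightarrow> periodic_chain_points G f E \<subseteq> periodic_chain_points G f F"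
  unfolding periodic_chain_points_def by blast

text \<open>The chain recurrent set depends only on the topology, not on the base: every open
  neighborhood contains a basic one, and every basic neighborhood contains an open one.\<close>

lemma chain_recurrent_set_iff:
  assumes "symmetric_nbhd_base G T \<B>"
  shows "x \<in> chain_recurrent_set G \<B> f \<longleftrightarrow>
    x \<in> carrier G \<and> (\<forall>W. openin T W \<longrightarrow> \<one>\<^bsub>G\<^esub> \<in> W \<longrightarrow> x \<in> periodic_chain_points G f W)"
proof -
  have "(\<forall>E\<in>\<B>. x \<in> periodic_chain_points G f E) \<longleftrightarrow>
        (\<forall>W. openin T W \<longrightarrow> \<one>\<^bsub>G\<^esub> \<in> W \<longrightarrow> x \<in> periodic_chain_points G f W)"
  proof safe
    fix W assume rec: "\<forall>E\<in>\<B>. x \<in> periodic_chain_points G f E" and W: "openin T W" "\<one>\<^bsub>G\<^esub> \<in> W"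
    have "neighbourhood_base_at \<one>\<^bsub>G\<^esub> (\<lambda>E. E \<in> \<B>) T"
      using assms by (simp add: symmetric_nbhd_base_def)
    then obtain E where "E \<in> \<B>" "E \<subseteq> W"
      using W unfolding neighbourhood_base_at_def by meson
    then show "x \<in> periodic_chain_points G f W"
      using rec periodic_chain_points_mono[of E W G f] by auto
  next
    fix E assume rec: "\<forall>W. openin T W \<longrightarrow> \<one>\<^bsub>G\<^esub> \<in> W \<longrightarrow> x \<in> periodic_chain_points G f W"
      and E: "E \<in> \<B>"
    have "neighborhood T \<one>\<^bsub>G\<^esub> E"
      using assms E by (simp add: symmetric_nbhd_base_def)
    then obtain W where "openin T W" "\<one>\<^bsub>G\<^esub> \<in> W" "W \<subseteq> E"
      unfolding neighborhood_def by auto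
    then show "x \<in> periodic_chain_points G f E"
      using rec periodic_chain_points_mono[of W E G f] by auto
  qed
  then show ?thesis
    by (simp add: chain_recurrent_set_def chain_leads_to_def periodic_chain_points_iff)
qed

lemma chain_recurrent_set_subset_carrier: "chain_recurrent_set G \<B> f \<subseteq> carrier G"
  by (auto simp: chain_recurrent_set_def)

section \<open>Functoriality of the chain recurrent set\<close>

text \<open>The homomorphism carries a chain for \<open>f\<close> with errors in \<open>\<phi>\<^sup>-\<^sup>1 W\<close> to a chain for \<open>g\<close> with
  errors in \<open>W\<close>.\<close>

lemma chain_recurrent_set_semiconjugacy:
  assumes "topological_group G T" "topological_group H U"
    and bases: "symmetric_nbhd_base G T \<B>" "symmetric_nbhd_base H U \<C>"
    and f: "f \<in> carrier G \<rightarrow> carrier G"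
    and hom: "\<phi> \<in> hom G H" and cont: "continuous_map T U \<phi>"
    and comm: "\<And>x. x \<in> carrier G \<Longrightarrow> \<phi> (f x) = g (\<phi> x)"
  shows "\<phi> ` chain_recurrent_set G \<B> f \<subseteq> chain_recurrent_set H \<C> g"
proof (intro image_subsetI)
  interpret G: topological_group G T by fact
  interpret H: topological_group H U by fact
  interpret group_hom G H \<phi>
    using hom by (simp add: group_hom_def group_hom_axioms_def G.group_axioms H.group_axioms)
  fix x assume x: "x \<in> chain_recurrent_set G \<B> f"
  then have xG: "x \<in> carrier G"
    by (rule subsetD[OF chain_recurrent_set_subset_carrier])
  have "\<phi> x \<in> periodic_chain_points H g W" if W: "openin U W" "\<one>\<^bsub>H\<^esub> \<in> W" for W
  proof -
    define V where "V = {v \<in> carrier G. \<phi> v \<in> W}"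
    have "openin T V"
      unfolding V_def G.topspace_eq_carrier[symmetric]
      using openin_continuous_map_preimage[OF cont W(1)] .
    moreover have "\<one>\<^bsub>G\<^esub> \<in> V"
      using W(2) by (simp add: V_def)
    ultimately have "x \<in> periodic_chain_points G f V"
      using x chain_recurrent_set_iff[OF bases(1)] by blast
    then obtain n s where s: "n \<ge> 1" "\<And>i. s i \<in> carrier G" "s 0 = x" "\<And>i::nat. s (i + n) = s i"
      "\<And>i. f (s i) \<otimes>\<^bsub>G\<^esub> inv\<^bsub>G\<^esub> (s (Suc i)) \<in> V"
      by (rule periodic_chain_pointsE) blast
    have "g (\<phi> (s i)) \<otimes>\<^bsub>H\<^esub> inv\<^bsub>H\<^esub> (\<phi> (s (Suc i))) \<in> W" for i
    proof -
      have "f (s i) \<in> carrier G"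
        using f s(2) by blast
      then have "\<phi> (f (s i) \<otimes>\<^bsub>G\<^esub> inv\<^bsub>G\<^esub> (s (Suc i))) =
          g (\<phi> (s i)) \<otimes>\<^bsub>H\<^esub> inv\<^bsub>H\<^esub> (\<phi> (s (Suc i)))"
        using s(2) by (simp add: comm)
      then show ?thesis
        using s(5)[of i] by (simp add: V_def)
    qed
    then show ?thesis
      using s by (intro periodic_chain_pointsI[of n "\<lambda>i. \<phi> (s i)"]) auto
  qed
  then show "\<phi> x \<in> chain_recurrent_set H \<C> g"
    using xG by (simp add: chain_recurrent_set_iff[OF bases(2)])
qed

section \<open>Products of chains\<close>

lemma (in topological_group) mult_neighborhood:
  assumes "openin T W" "\<one> \<in> W"
  obtains E where "openin T E" "\<one> \<in> E" "\<And>a b. a \<in> E \<Longrightarrow> b \<in> E \<Longrightarrow> a \<otimes> b \<in> W"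
proof -
  let ?M = "{p \<in> topspace (prod_topology T T). (\<lambda>(x, y). x \<otimes> y) p \<in> W}"
  have "openin (prod_topology T T) ?M"
    using openin_continuous_map_preimage[OF continuous_mult assms(1)] .
  moreover have "(\<one>, \<one>) \<in> ?M"
    using assms(2) by (simp add: topspace_eq_carrier)
  ultimately obtain A B where AB: "openin T A" "openin T B" "\<one> \<in> A" "\<one> \<in> B" "A \<times> B \<subseteq> ?M"
    unfolding openin_prod_topology_alt by meson
  show thesis
    by (rule that[of "A \<inter> B"]) (use AB in auto)
qed

lemma (in topological_group) continuous_map_mult:
  assumes "continuous_map X T a" "continuous_map X T b"
  shows "continuous_map X T (\<lambda>x. a x \<otimes> b x)"
  using continuous_map_compose[OF continuous_map_pairedI[OF assms] continuous_mult]
  by (simp add: o_def)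

lemma (in topological_group) continuous_map_inv:
  assumes "continuous_map X T a"
  shows "continuous_map X T (\<lambda>x. inv (a x))"
  using continuous_map_compose[OF assms continuous_inv] by (simp add: o_def)

text \<open>The two chains are multiplied termwise over a common period. In an abelian group the error of
  the product is the product of the errors.\<close>

lemma (in comm_group) periodic_chain_points_mult:
  assumes f: "f \<in> hom G G"
    and EW: "\<And>a b. a \<in> E \<Longrightarrow> b \<in> E \<Longrightarrow> a \<otimes> b \<in> W"
    and xy: "x \<in> periodic_chain_points G f E" "y \<in> periodic_chain_points G f E"
  shows "x \<otimes> y \<in> periodic_chain_points G f W"
proof -
  obtain m s where s: "m \<ge> 1" "\<And>i. s i \<in> carrier G" "s 0 = x" "\<And>i::nat. s (i + m) = s i"
    "\<And>i. f (s i) \<otimes> inv (s (Suc i)) \<in> E"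
    using xy(1) by (rule periodic_chain_pointsE) blast
  obtain n t where t: "n \<ge> 1" "\<And>i. t i \<in> carrier G" "t 0 = y" "\<And>i::nat. t (i + n) = t i"
    "\<And>i. f (t i) \<otimes> inv (t (Suc i)) \<in> E"
    using xy(2) by (rule periodic_chain_pointsE) blast
  have fcarr: "f z \<in> carrier G" if "z \<in> carrier G" for z
    using f that by (auto simp: hom_def)
  have err: "f (s i \<otimes> t i) \<otimes> inv (s (Suc i) \<otimes> t (Suc i)) =
      (f (s i) \<otimes> inv (s (Suc i))) \<otimes> (f (t i) \<otimes> inv (t (Suc i)))" for i
    using s(2) t(2) by (simp add: hom_mult[OF f] fcarr inv_mult m_ac)
  have "s (i + m * n) = s i" "t (i + m * n) = t i" for i
    using periodic_add_mult[of s m i n, OF s(4)] periodic_add_mult[of t n i m, OF t(4)]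
    by (simp_all add: mult.commute)
  then show ?thesis
    using s t err EW
    by (intro periodic_chain_pointsI[of "m * n" "\<lambda>i. s i \<otimes> t i"]) auto
qed

lemma fixed_up_to_error_imp_periodic_chain_point:
  assumes "v \<in> carrier G" "f v \<otimes>\<^bsub>G\<^esub> inv\<^bsub>G\<^esub> v \<in> E"
  shows "v \<in> periodic_chain_points G f E"
  using assms by (intro periodic_chain_pointsI[of 1 "\<lambda>_. v"]) auto

section \<open>Subgroup property, closedness and conjugacy invariance\<close>

lemma (in compact_abelian_topological_group) subgroup_chain_recurrent_set:
  assumes base: "symmetric_nbhd_base G T \<B>" and f: "continuous_endomorphism G T f"
  shows "subgroup (chain_recurrent_set G \<B> f) G"
proof (rule subgroupI)
  let ?CR = "chain_recurrent_set G \<B> f"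
  have fhom: "f \<in> hom G G"
    using f by (simp add: continuous_endomorphism_def)
  interpret f: group_hom G G f
    using fhom by (simp add: group_hom_def group_hom_axioms_def group_axioms)
  show "?CR \<subseteq> carrier G"
    by (rule chain_recurrent_set_subset_carrier)
  have "\<one> \<in> ?CR"
    by (simp add: chain_recurrent_set_iff[OF base] fixed_up_to_error_imp_periodic_chain_point)
  then show "?CR \<noteq> {}"
    by blast
  have "(\<lambda>x. inv x) \<in> hom G G"
    by (auto simp: hom_def inv_mult)
  then have "(\<lambda>x. inv x) ` ?CR \<subseteq> ?CR"
    by (intro chain_recurrent_set_semiconjugacy[OF topological_group_axioms
          topological_group_axioms base base])
       (auto intro: continuous_inv)
  then show "inv x \<in> ?CR" if "x \<in> ?CR" for x
    using that by blast
  show "x \<otimes> y \<in> ?CR" if "x \<in> ?CR" "y \<in> ?CR" for x y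
  proof -
    have "x \<otimes> y \<in> periodic_chain_points G f W" if W: "openin T W" "\<one> \<in> W" for W
    proof -
      obtain E where E: "openin T E" "\<one> \<in> E" "\<And>a b. a \<in> E \<Longrightarrow> b \<in> E \<Longrightarrow> a \<otimes> b \<in> W"
        using mult_neighborhood[OF W] by blast
      have "x \<in> periodic_chain_points G f E" "y \<in> periodic_chain_points G f E"
        using \<open>x \<in> ?CR\<close> \<open>y \<in> ?CR\<close> E(1,2) by (simp_all add: chain_recurrent_set_iff[OF base])
      then show ?thesis
        using periodic_chain_points_mult[OF fhom, of E W x y] E(3) by simp
    qed
    then show ?thesis
      using that by (simp add: chain_recurrent_set_iff[OF base])
  qed
qed

text \<open>If \<open>x\<close> is not chain recurrent, then neither is any \<open>y\<close> close to \<open>x\<close>: multiplying a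
  periodic chain through \<open>y\<close> by the constant chain \<open>y\<^sup>-\<^sup>1 x\<close> would give one through \<open>x\<close>.\<close>

lemma (in compact_abelian_topological_group) closedin_chain_recurrent_set:
  assumes base: "symmetric_nbhd_base G T \<B>" and f: "continuous_endomorphism G T f"
  shows "closedin T (chain_recurrent_set G \<B> f)"
proof -
  let ?CR = "chain_recurrent_set G \<B> f"
  have fhom: "f \<in> hom G G" and fcont: "continuous_map T T f"
    using f by (simp_all add: continuous_endomorphism_def)
  interpret f: group_hom G G f
    using fhom by (simp add: group_hom_def group_hom_axioms_def group_axioms)
  have "\<exists>N. openin T N \<and> x \<in> N \<and> N \<subseteq> topspace T - ?CR" if "x \<in> topspace T - ?CR" for x
  proof -
    have x: "x \<in> carrier G" "x \<notin> ?CR"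
      using that by (simp_all add: topspace_eq_carrier)
    obtain W where W: "openin T W" "\<one> \<in> W" "x \<notin> periodic_chain_points G f W"
      using x by (auto simp: chain_recurrent_set_iff[OF base])
    obtain E where E: "openin T E" "\<one> \<in> E" "\<And>a b. a \<in> E \<Longrightarrow> b \<in> E \<Longrightarrow> a \<otimes> b \<in> W"
      using mult_neighborhood[OF W(1,2)] by blast
    \<comment> \<open>The \<open>y\<close> for which the constant sequence \<open>y\<^sup>-\<^sup>1 x\<close> is a chain with errors in \<open>E\<close>.\<close>
    define N where "N = {y \<in> topspace T. f (inv y \<otimes> x) \<otimes> inv (inv y \<otimes> x) \<in> E}"
    have quot: "continuous_map T T (\<lambda>y. inv y \<otimes> x)"
      by (intro continuous_map_mult continuous_inv) (simp add: x(1) topspace_eq_carrier)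
    have "continuous_map T T (\<lambda>y. f (inv y \<otimes> x))"
      using continuous_map_compose[OF quot fcont] by (simp add: o_def)
    then have "openin T N"
      unfolding N_def
      by (intro openin_continuous_map_preimage[OF _ E(1)] continuous_map_mult
          continuous_map_inv quot)
    moreover have "x \<in> N"
      using x(1) E(2) by (simp add: N_def topspace_eq_carrier)
    moreover have "y \<notin> ?CR" if "y \<in> N" for y
    proof
      assume "y \<in> ?CR"
      then have "y \<in> periodic_chain_points G f E"
        using E(1,2) by (simp add: chain_recurrent_set_iff[OF base])
      moreover have y: "y \<in> carrier G"
        using that by (simp add: N_def topspace_eq_carrier)
      moreover have "inv y \<otimes> x \<in> periodic_chain_points G f E"
        using that x(1) y
        by (intro fixed_up_to_error_imp_periodic_chain_point) (simp_all add: N_def)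
      ultimately have "y \<otimes> (inv y \<otimes> x) \<in> periodic_chain_points G f W"
        using periodic_chain_points_mult[OF fhom, of E W y "inv y \<otimes> x"] E(3) by simp
      moreover have "y \<otimes> (inv y \<otimes> x) = x"
        using x(1) y by (simp add: m_assoc[symmetric])
      ultimately show False
        using W(3) by simp
    qed
    ultimately show ?thesis
      by (intro exI[of _ N]) (auto simp: N_def)
  qed
  then have "openin T (topspace T - ?CR)"
    by (subst openin_subopen) blast
  then show ?thesis
    using chain_recurrent_set_subset_carrier[of G \<B> f] by (auto simp: closedin_def topspace_eq_carrier)
qed

lemma chain_recurrent_set_conjugacy:
  assumes G: "topological_group G T" and H: "topological_group H U"
    and bases: "symmetric_nbhd_base G T \<B>" "symmetric_nbhd_base H U \<C>"
    and f: "f \<in> carrier G \<rightarrow> carrier G" and g: "g \<in> carrier H \<rightarrow> carrier H"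
    and conj: "topological_conjugacy G T f H U g \<phi>"
  shows "chain_recurrent_set H \<C> g = \<phi> ` chain_recurrent_set G \<B> f"
proof
  interpret G: topological_group G T by fact
  interpret H: topological_group H U by fact
  let ?\<psi> = "inv_into (carrier G) \<phi>"
  have iso: "\<phi> \<in> iso G H" and homeo: "homeomorphic_map T U \<phi>"
    and comm: "\<And>x. x \<in> carrier G \<Longrightarrow> \<phi> (f x) = g (\<phi> x)"
    using conj by (auto simp: topological_conjugacy_def)
  have bij: "bij_betw \<phi> (carrier G) (carrier H)" and hom: "\<phi> \<in> hom G H"
    using iso by (auto simp: iso_def)
  show "\<phi> ` chain_recurrent_set G \<B> f \<subseteq> chain_recurrent_set H \<C> g"
    using chain_recurrent_set_semiconjugacy[OF G H bases f hom _ comm] homeo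
    by (simp add: homeomorphic_imp_continuous_map)
  have \<psi>_hom: "?\<psi> \<in> hom H G"
    using G.iso_set_sym[OF iso] by (auto simp: iso_def)
  have \<phi>\<psi>: "\<phi> (?\<psi> y) = y" if "y \<in> carrier H" for y
    using bij_betw_inv_into_right[OF bij that] .
  have \<psi>\<phi>: "?\<psi> (\<phi> x) = x" if "x \<in> carrier G" for x
    using bij_betw_inv_into_left[OF bij that] .
  have \<psi>_carrier: "?\<psi> y \<in> carrier G" if "y \<in> carrier H" for y
    using bij_betw_apply[OF bij_betw_inv_into[OF bij] that] .
  have \<psi>_cont: "continuous_map U T ?\<psi>"
  proof -
    obtain h where h: "homeomorphic_maps T U \<phi> h"
      using homeo homeomorphic_map_maps by blast
    then have "continuous_map U T h"
      by (simp add: homeomorphic_maps_def)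
    moreover have "?\<psi> y = h y" if y: "y \<in> topspace U" for y
    proof -
      have "h y \<in> carrier G" "\<phi> (h y) = y"
        using h y G.topspace_eq_carrier
        by (auto simp: homeomorphic_maps_def continuous_map_def)
      then show ?thesis
        using \<psi>\<phi> by metis
    qed
    ultimately show ?thesis
      by (metis continuous_map_eq)
  qed
  have "?\<psi> (g y) = f (?\<psi> y)" if y: "y \<in> carrier H" for y
  proof -
    have "g y = \<phi> (f (?\<psi> y))"
      using comm[OF \<psi>_carrier[OF y]] \<phi>\<psi>[OF y] by simp
    then show ?thesis
      using \<psi>\<phi> \<psi>_carrier[OF y] f by auto
  qed
  then have \<psi>_CR: "?\<psi> ` chain_recurrent_set H \<C> g \<subseteq> chain_recurrent_set G \<B> f"
    by (rule chain_recurrent_set_semiconjugacy[OF H G bases(2,1) g \<psi>_hom \<psi>_cont])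
  show "chain_recurrent_set H \<C> g \<subseteq> \<phi> ` chain_recurrent_set G \<B> f"
  proof
    fix y assume y: "y \<in> chain_recurrent_set H \<C> g"
    then have "y \<in> carrier H"
      by (rule subsetD[OF chain_recurrent_set_subset_carrier])
    then have "y = \<phi> (?\<psi> y)"
      by (simp add: \<phi>\<psi>)
    moreover have "?\<psi> y \<in> chain_recurrent_set G \<B> f"
      using \<psi>_CR y by (rule subsetD[OF _ imageI])
    ultimately show "y \<in> \<phi> ` chain_recurrent_set G \<B> f"
      by (rule image_eqI)
  qed
qed

theorem proposition2p3:
  fixes G :: "'a monoid" and T :: "'a topology" and f :: "'a \<Rightarrow> 'a"
    and \<B> :: "'a monoid \<Rightarrow> 'a topology \<Rightarrow> 'a set set"
    and \<B>' :: "'b monoid \<Rightarrow> 'b topology \<Rightarrow> 'b set set"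
  assumes "\<And>K S. compact_abelian_topological_group K S \<Longrightarrow> symmetric_nbhd_base K S (\<B> K S)"
    and "\<And>K S. compact_abelian_topological_group K S \<Longrightarrow> symmetric_nbhd_base K S (\<B>' K S)"
    and "compact_abelian_topological_group G T"
    and "continuous_endomorphism G T f"
  shows "recurrent_subgroup
           (\<lambda>K S. chain_recurrent_set K (\<B> K S))
           (\<lambda>K S. chain_recurrent_set K (\<B>' K S)) G T f"
proof -
  interpret G: compact_abelian_topological_group G T by fact
  have base: "symmetric_nbhd_base G T (\<B> G T)"
    using assms(1,3) .
  have f: "f \<in> hom G G" "continuous_map T T f" "f \<in> carrier G \<rightarrow> carrier G"
    using assms(4) by (auto simp: continuous_endomorphism_def hom_def)
  have "f ` chain_recurrent_set G (\<B> G T) f \<subseteq> chain_recurrent_set G (\<B> G T) f"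
    by (rule chain_recurrent_set_semiconjugacy[OF G.topological_group_axioms
          G.topological_group_axioms base base f(3) f(1) f(2) refl])
  moreover have "chain_recurrent_set H (\<B>' H U) g = \<phi> ` chain_recurrent_set G (\<B> G T) f"
    if "compact_abelian_topological_group H U" and "continuous_endomorphism H U g"
      and "topological_conjugacy G T f H U g \<phi>" for H U g and \<phi> :: "'a \<Rightarrow> 'b"
  proof (rule chain_recurrent_set_conjugacy)
    show "topological_group H U"
      using that(1) by (simp add: compact_abelian_topological_group_def)
    show "g \<in> carrier H \<rightarrow> carrier H"
      using that(2) by (auto simp: continuous_endomorphism_def hom_def)
  qed (use that assms(2) base f(3) G.topological_group_axioms in auto)
  ultimately show ?thesis
    unfolding recurrent_subgroup_def
    using G.subgroup_chain_recurrent_set[OF base assms(4)]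
      G.closedin_chain_recurrent_set[OF base assms(4)]
    by blast
qed

end
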